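(* Let $(Z_n,S_n)_{n\ge0}$ be the embedded chain of a piecewise-deterministic Markov process, as described in the context. Let $n\ge1$ be an integer and $1\le i\le n$. For each $1\le j\le n$ with $j\ne i$, let $t_j\ge0$, and let $t$ be a positive real number. Then $$\bigvee_{j\neq i}\mathcal{F}^j_{t_j}\ \underset{\mathcal{G}_n}{\perp}\ \mathcal{F}^i_t\qquad\text{and}\qquad\mathcal{F}^i_t\ \underset{\sigma(Z_{i-1},Z_i)}{\perp}\ \mathcal{G}_n.$$ Moreover, for any $0\le s<t$ and $0\le i\le n-1$, $$\bigvee_{j\ne i+1}\mathcal{F}^j_s\ \underset{\mathcal{G}_n\vee\mathcal{F}^{i+1}_s}{\perp}\ \mathcal{F}^{i+1}_t\qquad\text{and}\qquad\mathcal{F}^{i+1}_t\ \underset{\sigma(Z_i,Z_{i+1})\vee\mathcal{F}^{i+1}_s}{\perp}\ \mathcal{G}_n.$$ (The indices $j$ range over $\{1,\dots,n\}$.)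
   Context: $E$ is an open subset of a separable metric space. $(Z_n)_{n\ge0}$ are the ($E$-valued) post-jump locations and $(S_n)_{n\ge0}$ ($S_0=0$) the interarrival times of a piecewise-deterministic Markov process with initial law $\nu_0$ of $Z_0$. The embedded chain $(Z_n,S_n)$ is generated by a stochastic dynamical system: there are measurable functions $\varphi,\psi$ and two mutually independent sequences $(\varepsilon_n)_{n\ge0}$ and $(\delta_n)_{n\ge0}$, each consisting of independent random variables, and both independent of $Z_0$, such that for any $n\ge1$, $$S_n=\varphi(Z_{n-1},\delta_{n-1}),\qquad Z_n=\psi(Z_{n-1},S_n,\varepsilon_{n-1}).$$ Notation: $\mathcal{G}_n=\sigma(Z_0,\dots,Z_n)$; for $j\ge1$, $N^j(t)=\mathbf{1}_{\{S_j\le t\}}$ and $\mathcal{F}^j_t=\sigma(N^j(u):0\le u\le t)$ is the natural filtration of $N^j$. For $\sigma$-fields, $\mathcal{A}\underset{\mathcal{H}}{\perp}\mathcal{B}$ means that $\mathcal{A}$ and $\mathcal{B}$ are conditionally independent given $\mathcal{H}$ (under $\mathbf{P}_{\nu_0}$), and $\vee$ denotes the generated $\sigma$-field. *)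

theory Defs
  imports "HOL-Probability.Probability"
begin

text \<open>Sub-\<open>\<sigma>\<close>-fields of \<open>M\<close> are represented as measures \<open>F\<close> with \<open>subalgebra M F\<close>, as in
  \<open>HOL-Probability.Conditional_Expectation\<close>; only \<open>space F\<close> and \<open>sets F\<close> matter.\<close>

definition generated_field ::
    "'a measure \<Rightarrow> 'b measure \<Rightarrow> 'i set \<Rightarrow> ('i \<Rightarrow> 'a \<Rightarrow> 'b) \<Rightarrow> 'a measure" where
  "generated_field M N I X =
     sigma (space M) (\<Union>i\<in>I. {X i -` A \<inter> space M | A. A \<in> sets N})"

text \<open>The base set is \<open>space M\<close>, so the join of the empty family is the trivial \<open>\<sigma>\<close>-field on
  \<open>space M\<close> (with the complete-lattice \<open>Sup\<close> on measures its space would be empty).\<close>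

definition join_fields :: "'a measure \<Rightarrow> 'a measure set \<Rightarrow> 'a measure" where
  "join_fields M \<H> = sigma (space M) (\<Union>H\<in>\<H>. sets H)"

definition cond_indep :: "'a measure \<Rightarrow> 'a measure \<Rightarrow> 'a measure \<Rightarrow> 'a measure \<Rightarrow> bool" where
  "cond_indep M H F G \<longleftrightarrow>
     subalgebra M H \<and> subalgebra M F \<and> subalgebra M G \<and>
     (\<forall>A\<in>sets F. \<forall>B\<in>sets G.
        AE \<omega> in M. real_cond_exp M H (indicat_real (A \<inter> B)) \<omega> =
          real_cond_exp M H (indicat_real A) \<omega> * real_cond_exp M H (indicat_real B) \<omega>)"

definition jump_indicator :: "(nat \<Rightarrow> 'a \<Rightarrow> real) \<Rightarrow> nat \<Rightarrow> real \<Rightarrow> 'a \<Rightarrow> real" where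
  "jump_indicator S j u \<omega> = (if S j \<omega> \<le> u then 1 else 0)"

definition jump_filtration ::
    "'a measure \<Rightarrow> (nat \<Rightarrow> 'a \<Rightarrow> real) \<Rightarrow> nat \<Rightarrow> real \<Rightarrow> 'a measure" where
  "jump_filtration M S j t = generated_field M borel {0..t} (jump_indicator S j)"

abbreviation state_space :: "'e::topological_space set \<Rightarrow> 'e measure" where
  "state_space E \<equiv> restrict_space borel E"

abbreviation time_space :: "real measure" where
  "time_space \<equiv> restrict_space borel {0..}"

text \<open>The separable metric space containing \<open>E\<close> is the type \<open>'e\<close>: for metric spaces,
  separability is second countability. The noises \<open>\<epsilon>\<close> and \<open>\<delta>\<close> take values in arbitrary
  measurable spaces \<open>N\<^sub>\<epsilon>\<close> and \<open>N\<^sub>\<delta>\<close>. Independence of \<open>Z 0\<close> from the noise is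
  independence from the pair of sequences, i.e. from \<open>\<sigma>(\<epsilon>\<^sub>k, \<delta>\<^sub>k : k \<ge> 0)\<close>; it is phrased
  with \<open>\<sigma>\<close>-fields because \<open>indep_var\<close> requires both variables to have the same type.\<close>

locale pdmp_embedded_chain = prob_space M
  for M :: "'a measure" +
  fixes E :: "'e::{metric_space, second_countable_topology} set"
    and \<nu>\<^sub>0 :: "'e measure"
    and Z :: "nat \<Rightarrow> 'a \<Rightarrow> 'e"
    and S :: "nat \<Rightarrow> 'a \<Rightarrow> real"
    and N\<^sub>\<epsilon> :: "'b measure"
    and N\<^sub>\<delta> :: "'c measure"
    and \<epsilon> :: "nat \<Rightarrow> 'a \<Rightarrow> 'b"
    and \<delta> :: "nat \<Rightarrow> 'a \<Rightarrow> 'c"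
    and \<phi> :: "'e \<Rightarrow> 'c \<Rightarrow> real"
    and \<psi> :: "'e \<Rightarrow> real \<Rightarrow> 'b \<Rightarrow> 'e"
  assumes open_E: "open E"
    and Z_measurable: "\<And>n. Z n \<in> M \<rightarrow>\<^sub>M state_space E"
    and S_measurable: "\<And>n. S n \<in> M \<rightarrow>\<^sub>M time_space"
    and Z_init: "distr M (state_space E) (Z 0) = \<nu>\<^sub>0"
    and S_init: "\<And>\<omega>. \<omega> \<in> space M \<Longrightarrow> S 0 \<omega> = 0"
    and phi_measurable:
      "(\<lambda>(z, d). \<phi> z d) \<in> state_space E \<Otimes>\<^sub>M N\<^sub>\<delta> \<rightarrow>\<^sub>M time_space"
    and psi_measurable:
      "(\<lambda>(z, s, e). \<psi> z s e) \<in> state_space E \<Otimes>\<^sub>M (time_space \<Otimes>\<^sub>M N\<^sub>\<epsilon>) \<rightarrow>\<^sub>M state_space E"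
    and eps_indep: "indep_vars (\<lambda>_. N\<^sub>\<epsilon>) \<epsilon> UNIV"
    and delta_indep: "indep_vars (\<lambda>_. N\<^sub>\<delta>) \<delta> UNIV"
    and eps_delta_indep:
      "indep_set (sets (generated_field M N\<^sub>\<epsilon> UNIV \<epsilon>)) (sets (generated_field M N\<^sub>\<delta> UNIV \<delta>))"
    and noise_init_indep:
      "indep_set (sets (generated_field M (state_space E) {0} Z))
         (sets (join_fields M {generated_field M N\<^sub>\<epsilon> UNIV \<epsilon>, generated_field M N\<^sub>\<delta> UNIV \<delta>}))"
    and S_rec: "\<And>n \<omega>. n \<ge> 1 \<Longrightarrow> \<omega> \<in> space M \<Longrightarrow> S n \<omega> = \<phi> (Z (n - 1) \<omega>) (\<delta> (n - 1) \<omega>)"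
    and Z_rec: "\<And>n \<omega>. n \<ge> 1 \<Longrightarrow> \<omega> \<in> space M \<Longrightarrow>
                  Z n \<omega> = \<psi> (Z (n - 1) \<omega>) (S n \<omega>) (\<epsilon> (n - 1) \<omega>)"

end

theory Submission
  imports Defs
begin

text \<open>Everything follows from the graphoid rules for conditional independence of \<open>\<sigma>\<close>-fields, chiefly
  weak union: if \<open>A \<bottom> B\<close> given \<open>H\<close> and \<open>H \<subseteq> H' \<subseteq> H \<or> B\<close>, then \<open>A \<bottom> H \<or> B\<close> given \<open>H'\<close>.
  Let \<open>D = \<sigma>(\<epsilon>\<^sub>m, \<delta>\<^sub>m)\<close> be the noise driving the step from \<open>m\<close> to \<open>m + 1\<close> and \<open>Q\<close> the \<open>\<sigma>\<close>-field of
  \<open>Z\<^sub>0\<close> and all other noise. From \<open>D \<bottom> Q\<close> one enlarges the trivial conditioning field first to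
  \<open>\<sigma>(Z\<^sub>m) \<subseteq> Q\<close>, then to \<open>H = \<sigma>(Z\<^sub>m, Z\<^sub>m\<^sub>+\<^sub>1) \<subseteq> \<sigma>(Z\<^sub>m) \<or> D\<close>, and obtains
  \<open>\<sigma>(Z\<^sub>m) \<or> D \<bottom> H \<or> Q\<close> given \<open>H\<close>. The left field contains \<open>\<sigma>(S\<^sub>m\<^sub>+\<^sub>1)\<close>, the right one all \<open>Z\<^sub>k\<close> and all
  \<open>S\<^sub>j\<close> with \<open>j \<noteq> m + 1\<close>, so each of the four claims is one or two more applications of weak union.\<close>

section \<open>Inclusions, joins and generators of sub-sigma-fields\<close>

lemma subalgebra_trans:
  assumes "subalgebra K L" and "subalgebra L N"
  shows "subalgebra K N"
  using assms by (auto simp: subalgebra_def)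

lemma subalgebra_refl: "subalgebra K K"
  by (simp add: subalgebra_def)

lemma space_join_fields [simp]: "space (join_fields M \<H>) = space M"
  unfolding join_fields_def by (rule space_measure_of_conv)

lemma sets_join_fields:
  assumes "\<And>H. H \<in> \<H> \<Longrightarrow> subalgebra M H"
  shows "sets (join_fields M \<H>) = sigma_sets (space M) (\<Union>H\<in>\<H>. sets H)"
  unfolding join_fields_def
proof (rule sets_measure_of)
  show "(\<Union>H\<in>\<H>. sets H) \<subseteq> Pow (space M)"
    using assms sets.space_closed[of M] unfolding subalgebra_def by blast
qed

lemma subalgebra_join_fields_upper:
  assumes "\<And>H. H \<in> \<H> \<Longrightarrow> subalgebra M H" and "H \<in> \<H>"
  shows "subalgebra (join_fields M \<H>) H"
  using assms sets_join_fields[OF assms(1)] by (auto simp: subalgebra_def)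

lemma subalgebra_join_fields_least:
  assumes "space K = space M" and "\<And>H. H \<in> \<H> \<Longrightarrow> subalgebra M H"
    and "\<And>H. H \<in> \<H> \<Longrightarrow> subalgebra K H"
  shows "subalgebra K (join_fields M \<H>)"
proof -
  have "sigma_sets (space K) (\<Union>H\<in>\<H>. sets H) \<subseteq> sets K"
    using assms(3) by (intro sets.sigma_sets_subset) (auto simp: subalgebra_def)
  then show ?thesis
    using assms(1) sets_join_fields[OF assms(2)] by (simp add: subalgebra_def)
qed

lemma space_generated_field [simp]: "space (generated_field M N I X) = space M"
  unfolding generated_field_def by (rule space_measure_of_conv)

lemma sets_generated_field:
  "sets (generated_field M N I X) =
     sigma_sets (space M) (\<Union>i\<in>I. {X i -` A \<inter> space M | A. A \<in> sets N})"
  unfolding generated_field_def by (intro sets_measure_of) auto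

lemma measurable_generated_field:
  assumes "i \<in> I" and "X i \<in> M \<rightarrow>\<^sub>M N"
  shows "X i \<in> generated_field M N I X \<rightarrow>\<^sub>M N"
  using assms by (auto simp: measurable_def sets_generated_field)

text \<open>Minimality of the generated field. With it, inclusions between fields are read off from
  measurability of the generating maps.\<close>

lemma subalgebra_generated_field:
  assumes "space K = space M" and "\<And>i. i \<in> I \<Longrightarrow> X i \<in> K \<rightarrow>\<^sub>M N"
  shows "subalgebra K (generated_field M N I X)"
proof -
  have "sigma_sets (space K) (\<Union>i\<in>I. {X i -` A \<inter> space M | A. A \<in> sets N}) \<subseteq> sets K"
    using assms by (intro sets.sigma_sets_subset) (auto simp flip: assms(1))
  then show ?thesis
    using assms(1) by (simp add: subalgebra_def sets_generated_field)
qed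

section \<open>Conditional independence: symmetry, monotonicity, and joins of two fields\<close>

lemma cond_indepD:
  assumes "cond_indep M H A B"
  shows "subalgebra M H" "subalgebra M A" "subalgebra M B"
  using assms by (simp_all add: cond_indep_def)

lemma cond_indep_sym: "cond_indep M H A B \<Longrightarrow> cond_indep M H B A"
  unfolding cond_indep_def by (subst Int_commute, subst mult.commute) blast

lemma cond_indep_mono:
  assumes "cond_indep M H A B" and "subalgebra A A'" and "subalgebra B B'"
  shows "cond_indep M H A' B'"
  using assms unfolding cond_indep_def by (auto simp: subalgebra_def subset_iff)

lemma subalgebra_join2:
  assumes "subalgebra M H" and "subalgebra M B"
  shows "subalgebra M (join_fields M {H, B})"
    and "subalgebra (join_fields M {H, B}) H"
    and "subalgebra (join_fields M {H, B}) B"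
  using assms by (auto intro!: subalgebra_join_fields_least subalgebra_join_fields_upper)

text \<open>The rectangles \<open>c \<inter> b\<close>, unlike the union of the two fields, form a
  system closed under intersection, so a Dynkin argument on the join can start from them.\<close>

lemma sets_join2:
  assumes "subalgebra M H" and "subalgebra M B"
  shows "sets (join_fields M {H, B}) = sigma_sets (space M) {c \<inter> b | c b. c \<in> sets H \<and> b \<in> sets B}"
proof -
  have sp: "space H = space M" "space B = space M"
    using assms by (auto simp: subalgebra_def)
  have "sigma_sets (space M) (sets H \<union> sets B) = sigma_sets (space M) {c \<inter> b | c b. c \<in> sets H \<and> b \<in> sets B}"
  proof (rule sigma_sets_eqI)
    fix x assume "x \<in> sets H \<union> sets B"
    \<comment> \<open>A member of either field is a rectangle whose other side is the whole
      space.\<close>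
    then have "x = x \<inter> space B \<and> x \<in> sets H \<or> x = space H \<inter> x \<and> x \<in> sets B"
      using sets.sets_into_space[of x H] sets.sets_into_space[of x B] sp by auto
    then have "x \<in> {c \<inter> b | c b. c \<in> sets H \<and> b \<in> sets B}"
      by (blast intro: sets.top)
    then show "x \<in> sigma_sets (space M) {c \<inter> b | c b. c \<in> sets H \<and> b \<in> sets B}"
      by (rule sigma_sets.Basic)
  next
    fix x assume x: "x \<in> {c \<inter> b | c b. c \<in> sets H \<and> b \<in> sets B}"
    interpret sigma_algebra "space M" "sigma_sets (space M) (sets H \<union> sets B)"
      using sp sets.space_closed[of H] sets.space_closed[of B]
      by (intro sigma_algebra_sigma_sets) auto
    show "x \<in> sigma_sets (space M) (sets H \<union> sets B)"
      using x by (auto intro!: Int intro: sigma_sets.Basic)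
  qed
  then show ?thesis
    using sets_join_fields[of "{H, B}" M] assms by auto
qed

section \<open>Conditional independence through conditional expectations; weak union\<close>

context prob_space
begin

lemma sigma_finite_subalgebra_prob:
  assumes "subalgebra M F"
  shows "sigma_finite_subalgebra M F"
proof -
  interpret finite_measure_subalgebra M F
    by unfold_locales (rule assms)
  show ?thesis by unfold_locales
qed

lemma integrable_indicat: "A \<in> events \<Longrightarrow> integrable M (indicat_real A)"
  by (rule integrable_real_indicator) (auto simp: emeasure_eq_measure)

lemma integrable_indicat_mult_cond_exp:
  assumes "subalgebra M H" and "A \<in> events" and "D \<in> events"
  shows "integrable M (\<lambda>\<omega>. indicat_real D \<omega> * real_cond_exp M H (indicat_real A) \<omega>)"
proof -
  interpret H: sigma_finite_subalgebra M H
    using assms(1) by (rule sigma_finite_subalgebra_prob)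
  show ?thesis
    using integrable_mult_indicator[OF assms(3) H.real_cond_exp_int(1)[OF integrable_indicat[OF assms(2)]]]
    by simp
qed

text \<open>This tests the conditional expectation of 1_a given \<open>H\<close> on the rectangles
  that generate the join of \<open>H\<close> and \<open>B\<close>. The factor 1_b is conditioned
  together with 1_a, split off by conditional independence and then unconditioned; the weight 1_c
  stays outside because it is \<open>H\<close>-measurable.\<close>

lemma cond_indep_integral:
  assumes ci: "cond_indep M H A B" and a: "a \<in> sets A" and b: "b \<in> sets B" and c: "c \<in> sets H"
  shows "(\<integral>\<omega>. indicat_real (c \<inter> b) \<omega> * indicat_real a \<omega> \<partial>M) =
    (\<integral>\<omega>. indicat_real (c \<inter> b) \<omega> * real_cond_exp M H (indicat_real a) \<omega> \<partial>M)"
proof -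
  note sub = cond_indepD[OF ci]
  interpret H: sigma_finite_subalgebra M H
    using sub(1) by (rule sigma_finite_subalgebra_prob)
  have [measurable]: "a \<in> events" "b \<in> events" "c \<in> events"
    using sub a b c by (auto simp: subalgebra_def)
  have [measurable]: "c \<in> sets H" by fact
  let ?p = "real_cond_exp M H (indicat_real a)"
  have "(\<integral>\<omega>. indicat_real (c \<inter> b) \<omega> * indicat_real a \<omega> \<partial>M) =
      (\<integral>\<omega>. indicat_real c \<omega> * indicat_real (a \<inter> b) \<omega> \<partial>M)"
    by (intro Bochner_Integration.integral_cong) (auto split: split_indicator)
  also have "\<dots> = (\<integral>\<omega>. indicat_real c \<omega> * real_cond_exp M H (indicat_real (a \<inter> b)) \<omega> \<partial>M)"
    by (intro H.real_cond_exp_intg(2)[symmetric])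
      (auto simp: indicator_inter_arith[symmetric] intro!: integrable_indicat)
  also have "\<dots> = (\<integral>\<omega>. indicat_real c \<omega> * ?p \<omega> * real_cond_exp M H (indicat_real b) \<omega> \<partial>M)"
  proof (rule integral_cong_AE)
    have "AE \<omega> in M. real_cond_exp M H (indicat_real (a \<inter> b)) \<omega> =
        ?p \<omega> * real_cond_exp M H (indicat_real b) \<omega>"
      using ci a b by (simp add: cond_indep_def)
    then show "AE \<omega> in M. indicat_real c \<omega> * real_cond_exp M H (indicat_real (a \<inter> b)) \<omega> =
        indicat_real c \<omega> * ?p \<omega> * real_cond_exp M H (indicat_real b) \<omega>"
      by eventually_elim simp
  qed auto
  \<comment> \<open>The conditioning of 1_b is undone under the integral, its weight 1_c times
    \<open>?p\<close> being \<open>H\<close>-measurable.\<close>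
  also have "\<dots> = (\<integral>\<omega>. indicat_real c \<omega> * ?p \<omega> * indicat_real b \<omega> \<partial>M)"
  proof (rule H.real_cond_exp_intg(2))
    show "integrable M (\<lambda>\<omega>. indicat_real c \<omega> * ?p \<omega> * indicat_real b \<omega>)"
      using integrable_indicat_mult_cond_exp[OF sub(1) \<open>a \<in> events\<close>, of "c \<inter> b"]
      by (simp add: indicator_inter_arith ac_simps)
  qed auto
  also have "\<dots> = (\<integral>\<omega>. indicat_real (c \<inter> b) \<omega> * ?p \<omega> \<partial>M)"
    by (simp add: indicator_inter_arith ac_simps)
  finally show ?thesis .
qed

text \<open>One-sided form of conditional independence: beyond \<open>H\<close>, the field
  \<open>B\<close> carries no information about \<open>A\<close>. By
  \<open>cond_indep_integral\<close> the two integrals agree on rectangles, and a Dynkin argument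
  extends the agreement to the join.\<close>

lemma cond_exp_join_eq:
  assumes ci: "cond_indep M H A B" and a: "a \<in> sets A"
  shows "AE \<omega> in M. real_cond_exp M (join_fields M {H, B}) (indicat_real a) \<omega> =
    real_cond_exp M H (indicat_real a) \<omega>"
proof -
  note sub = cond_indepD[OF ci]
  let ?J = "join_fields M {H, B}"
  let ?p = "real_cond_exp M H (indicat_real a)"
  note J = subalgebra_join2[OF sub(1,3)]
  interpret H: sigma_finite_subalgebra M H
    using sub(1) by (rule sigma_finite_subalgebra_prob)
  interpret J: sigma_finite_subalgebra M ?J
    using J(1) by (rule sigma_finite_subalgebra_prob)
  have sp: "space H = space M" "space B = space M"
    using sub by (auto simp: subalgebra_def)
  have aM [measurable]: "a \<in> events"
    using sub a by (auto simp: subalgebra_def)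
  let ?G = "{c \<inter> b | c b. c \<in> sets H \<and> b \<in> sets B}"
  let ?I = "\<lambda>f d. \<integral>\<omega>. indicat_real d \<omega> * f \<omega> \<partial>M"
  have ev: "sigma_sets (space M) ?G \<subseteq> events"
    using J(1) sets_join2[OF sub(1,3)] by (simp add: subalgebra_def)
  have int: "integrable M (\<lambda>\<omega>. indicat_real d \<omega> * f \<omega>)" if "d \<in> events" "integrable M f" for d and f :: "'a \<Rightarrow> real"
    using integrable_mult_indicator[OF that] by simp
  have fs: "integrable M (indicat_real a)" "integrable M ?p"
    using integrable_indicat[OF aM] H.real_cond_exp_int(1) by auto
  \<comment> \<open>\<open>I_compl\<close> and \<open>I_union\<close> supply the two closure
    properties of the Dynkin argument.\<close>
  have I_compl: "?I f (space M - d) = (\<integral>\<omega>. f \<omega> \<partial>M) - ?I f d" if "d \<in> events" "integrable M f" for d and f :: "'a \<Rightarrow> real"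
  proof -
    have "?I f (space M - d) = (\<integral>\<omega>. f \<omega> - indicat_real d \<omega> * f \<omega> \<partial>M)"
      by (intro Bochner_Integration.integral_cong) (auto split: split_indicator)
    then show ?thesis
      using that int by simp
  qed
  have I_union: "?I f (\<Union>i. D i) = (\<Sum>i. ?I f (D i))"
    if "disjoint_family D" "range D \<subseteq> events" "integrable M f" for D :: "nat \<Rightarrow> 'a set" and f :: "'a \<Rightarrow> real"
  proof -
    have "set_lebesgue_integral M (\<Union>i. D i) f = (\<Sum>i. set_lebesgue_integral M (D i) f)"
      using that by (intro lebesgue_integral_countable_add)
        (auto simp: set_integrable_def disjoint_family_on_def intro!: int)
    then show ?thesis by (simp add: set_lebesgue_integral_def)
  qed
  have stable: "Int_stable ?G"
    by (rule Int_stableI) (auto, metis Int_assoc Int_left_commute sets.Int)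
  have closed: "?G \<subseteq> Pow (space M)"
    using sp sets.space_closed[of H] by auto
  have eq: "?I (indicat_real a) d = ?I ?p d" if "d \<in> sigma_sets (space M) ?G" for d
    using stable closed that
  proof (induction rule: sigma_sets_induct_disjoint)
    case (basic d)
    then show ?case using cond_indep_integral[OF ci a] by auto
  next
    case empty
    then show ?case by simp
  next
    case (compl d)
    then have "d \<in> events" using ev by blast
    \<comment> \<open>Complements also need equal total integrals: conditioning preserves the
      expectation.\<close>
    with compl.IH show ?case
      by (simp only: I_compl fs H.real_cond_exp_int(2)[OF fs(1)])
  next
    case (union D)
    then have "range D \<subseteq> events" using ev by blast
    with union show ?case
      by (simp only: I_union fs)
  qed
  show ?thesis
  proof (rule J.real_cond_exp_charact)
    fix d assume "d \<in> sets ?J"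
    then show "(\<integral>\<omega>\<in>d. indicat_real a \<omega> \<partial>M) = (\<integral>\<omega>\<in>d. ?p \<omega> \<partial>M)"
      using eq sets_join2[OF sub(1,3)] by (simp add: set_lebesgue_integral_def)
  next
    show "?p \<in> borel_measurable ?J"
      using J(2) by (intro measurable_from_subalg[of ?J H]) auto
  qed (use fs in auto)
qed

text \<open>Converse of \<open>cond_exp_join_eq\<close>. The indicator of a set of \<open>W\<close>
  is pulled out of the conditioning on \<open>W\<close>; the tower property down to \<open>H\<close>
  then yields the product.\<close>

lemma cond_indep_if_cond_exp_eq:
  assumes sub: "subalgebra M W" "subalgebra W H" "subalgebra M A"
    and eq: "\<And>a. a \<in> sets A \<Longrightarrow>
      AE \<omega> in M. real_cond_exp M W (indicat_real a) \<omega> = real_cond_exp M H (indicat_real a) \<omega>"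
  shows "cond_indep M H A W"
  unfolding cond_indep_def
proof (intro conjI ballI)
  show MH: "subalgebra M H"
    using sub subalgebra_trans by blast
  fix a b assume a: "a \<in> sets A" and b: "b \<in> sets W"
  interpret H: sigma_finite_subalgebra M H
    using MH by (rule sigma_finite_subalgebra_prob)
  interpret W: sigma_finite_subalgebra M W
    using sub(1) by (rule sigma_finite_subalgebra_prob)
  have [measurable]: "a \<in> events" "b \<in> events" "b \<in> sets W"
    using sub a b by (auto simp: subalgebra_def)
  let ?p = "real_cond_exp M H (indicat_real a)"
  have ab: "indicat_real (a \<inter> b) = (\<lambda>\<omega>. indicat_real b \<omega> * indicat_real a \<omega>)"
    by (auto split: split_indicator)
  have iab: "integrable M (indicat_real (a \<inter> b))"
    by (intro integrable_indicat) auto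
  have pb: "integrable M (\<lambda>\<omega>. ?p \<omega> * indicat_real b \<omega>)"
    using integrable_indicat_mult_cond_exp[OF MH, of a b] by (simp add: mult.commute)
  have "AE \<omega> in M. real_cond_exp M W (indicat_real (a \<inter> b)) \<omega> =
      indicat_real b \<omega> * real_cond_exp M W (indicat_real a) \<omega>"
    unfolding ab using iab by (intro W.real_cond_exp_mult) (auto simp: ab)
  with eq[OF a] have 1: "AE \<omega> in M. real_cond_exp M W (indicat_real (a \<inter> b)) \<omega> = ?p \<omega> * indicat_real b \<omega>"
    by eventually_elim simp
  \<comment> \<open>Identity \<open>1\<close> is now conditioned on \<open>H\<close>: its left side
    collapses by the tower property (\<open>4\<close>), and on its right side the
    \<open>H\<close>-measurable \<open>?p\<close> comes out (\<open>3\<close>).\<close>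
  have 2: "AE \<omega> in M. real_cond_exp M H (real_cond_exp M W (indicat_real (a \<inter> b))) \<omega> =
      real_cond_exp M H (\<lambda>\<omega>. ?p \<omega> * indicat_real b \<omega>) \<omega>"
    using 1 by (intro H.real_cond_exp_cong) auto
  have 3: "AE \<omega> in M. real_cond_exp M H (\<lambda>\<omega>. ?p \<omega> * indicat_real b \<omega>) \<omega> =
      ?p \<omega> * real_cond_exp M H (indicat_real b) \<omega>"
    using pb by (intro H.real_cond_exp_mult) auto
  have 4: "AE \<omega> in M. real_cond_exp M H (real_cond_exp M W (indicat_real (a \<inter> b))) \<omega> =
      real_cond_exp M H (indicat_real (a \<inter> b)) \<omega>"
    using sub iab by (intro H.real_cond_exp_nested_subalg) auto
  from 2 3 4 show "AE \<omega> in M. real_cond_exp M H (indicat_real (a \<inter> b)) \<omega> =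
      real_cond_exp M H (indicat_real a) \<omega> * real_cond_exp M H (indicat_real b) \<omega>"
    by eventually_elim simp
qed (use sub in auto)

text \<open>Condition both sides of the hypothesis on \<open>H'\<close>: the left one becomes the
  conditional expectation given \<open>H'\<close> by the tower property, the right one is already
  \<open>H'\<close>-measurable and stays.\<close>

lemma cond_exp_eq_between:
  assumes sub: "subalgebra M W" "subalgebra W H'" "subalgebra H' H" and a: "a \<in> events"
    and eq: "AE \<omega> in M. real_cond_exp M W (indicat_real a) \<omega> = real_cond_exp M H (indicat_real a) \<omega>"
  shows "AE \<omega> in M. real_cond_exp M W (indicat_real a) \<omega> = real_cond_exp M H' (indicat_real a) \<omega>"
proof -
  have MH': "subalgebra M H'" and MH: "subalgebra M H"
    using sub subalgebra_trans by blast+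
  interpret H: sigma_finite_subalgebra M H
    using MH by (rule sigma_finite_subalgebra_prob)
  interpret H': sigma_finite_subalgebra M H'
    using MH' by (rule sigma_finite_subalgebra_prob)
  note ia = integrable_indicat[OF a]
  have 1: "AE \<omega> in M. real_cond_exp M H' (real_cond_exp M W (indicat_real a)) \<omega> =
      real_cond_exp M H' (indicat_real a) \<omega>"
    using sub ia by (intro H'.real_cond_exp_nested_subalg) auto
  have 2: "AE \<omega> in M. real_cond_exp M H' (real_cond_exp M W (indicat_real a)) \<omega> =
      real_cond_exp M H' (real_cond_exp M H (indicat_real a)) \<omega>"
    using eq by (intro H'.real_cond_exp_cong) auto
  have 3: "AE \<omega> in M. real_cond_exp M H' (real_cond_exp M H (indicat_real a)) \<omega> =
      real_cond_exp M H (indicat_real a) \<omega>"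
    using ia sub(3) by (intro H'.real_cond_exp_F_meas H.real_cond_exp_int measurable_from_subalg[of H' H]) auto
  from eq 1 2 3 show ?thesis
    by eventually_elim simp
qed

text \<open>The conditional expectation given the join equals the one given \<open>H\<close>, hence
  also the one given the intermediate \<open>H'\<close>; the converse criterion, with the join as
  \<open>W\<close>, concludes.\<close>

proposition cond_indep_weak_union:
  assumes ci: "cond_indep M H A B"
    and sub: "subalgebra H' H" "subalgebra (join_fields M {H, B}) H'"
  shows "cond_indep M H' A (join_fields M {H, B})"
proof (rule cond_indep_if_cond_exp_eq[OF _ sub(2)])
  show MJ: "subalgebra M (join_fields M {H, B})"
    using cond_indepD(1,3)[OF ci] by (rule subalgebra_join2(1))
  fix a assume a: "a \<in> sets A"
  then have "a \<in> events" using cond_indepD(2)[OF ci] by (auto simp: subalgebra_def)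
  then show "AE \<omega> in M. real_cond_exp M (join_fields M {H, B}) (indicat_real a) \<omega> =
      real_cond_exp M H' (indicat_real a) \<omega>"
    using cond_exp_join_eq[OF ci a] by (rule cond_exp_eq_between[OF MJ sub(2,1)])
next
  show "subalgebra M A" using ci by (rule cond_indepD)
qed

corollary cond_indep_weak_union':
  assumes ci: "cond_indep M H A B"
    and sub: "subalgebra H' H" "subalgebra (join_fields M {H, B}) H'"
  shows "cond_indep M H' A B"
  using cond_indep_weak_union[OF assms] subalgebra_refl subalgebra_join2(3)[OF cond_indepD(1)[OF ci] cond_indepD(3)[OF ci]]
  by (rule cond_indep_mono)

text \<open>Starting point for weak union: over the trivial field, conditional expectations of
  indicators are probabilities.\<close>

lemma cond_indep_trivial:
  assumes sub: "subalgebra M A" "subalgebra M B" and ind: "indep_set (sets A) (sets B)"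
  shows "cond_indep M (join_fields M {}) A B"
proof -
  let ?T = "join_fields M {}"
  have sT: "sets ?T = {{}, space M}"
    by (subst sets_join_fields) (auto simp: sigma_sets_empty_eq)
  have MT: "subalgebra M ?T"
    by (auto simp: subalgebra_def sT)
  interpret T: sigma_finite_subalgebra M ?T
    using MT by (rule sigma_finite_subalgebra_prob)
  \<comment> \<open>Only the empty set and the whole space have to be tested, so the constant passes
    the characterisation.\<close>
  have const: "AE \<omega> in M. real_cond_exp M ?T (indicat_real a) \<omega> = prob a" if "a \<in> events" for a
  proof (rule T.real_cond_exp_charact)
    fix d assume "d \<in> sets ?T"
    then show "(\<integral>\<omega>\<in>d. indicat_real a \<omega> \<partial>M) = (\<integral>\<omega>\<in>d. prob a \<partial>M)"
      using that by (auto simp: sT set_lebesgue_integral_def indicator_inter_arith[symmetric] prob_space Int_absorb1 sets.sets_into_space)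
  qed (use that integrable_indicat in auto)
  show ?thesis
    unfolding cond_indep_def
  proof (intro conjI ballI)
    fix a b assume a: "a \<in> sets A" and b: "b \<in> sets B"
    then have "a \<in> events" "b \<in> events" "prob (a \<inter> b) = prob a * prob b"
      using sub indep_setD[OF ind] by (auto simp: subalgebra_def)
    with const[of a] const[of b] const[of "a \<inter> b"]
    show "AE \<omega> in M. real_cond_exp M ?T (indicat_real (a \<inter> b)) \<omega> =
        real_cond_exp M ?T (indicat_real a) \<omega> * real_cond_exp M ?T (indicat_real b) \<omega>"
      by auto
  qed (use sub MT in auto)
qed

section \<open>Assembling independent families\<close>

lemma indep_sets_image:
  assumes "inj_on f I" and "indep_sets (\<lambda>i. F (f i)) I"
  shows "indep_sets F (f ` I)"
proof (rule indep_setsI)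
  show "F j \<subseteq> events" if "j \<in> f ` I" for j
    using that assms(2) by (auto simp: indep_sets_def)
  fix A J assume J: "J \<noteq> {}" "J \<subseteq> f ` I" "finite J" "\<forall>j\<in>J. A j \<in> F j"
  then obtain K where K: "K \<subseteq> I" "J = f ` K" by (auto simp: subset_image_iff)
  have inj: "inj_on f K" using assms(1) K(1) by (rule inj_on_subset)
  with J K have "finite K" "K \<noteq> {}" by (auto dest: finite_imageD)
  with J K have "prob (\<Inter>k\<in>K. A (f k)) = (\<Prod>k\<in>K. prob (A (f k)))"
    by (intro indep_setsD[OF assms(2)]) auto
  then show "prob (\<Inter>j\<in>J. A j) = (\<Prod>j\<in>J. prob (A j))"
    using inj K by (simp add: prod.reindex image_image)
qed

text \<open>A finite subfamily splits into its parts in \<open>I\<close> and in \<open>J\<close>.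
  Each partial intersection lies in the sigma-field of its block, so \<open>ind\<close> separates
  the two, and independence inside the blocks finishes.\<close>

lemma indep_sets_Un:
  assumes F: "indep_sets F I" "indep_sets F J" and disj: "I \<inter> J = {}"
    and ind: "indep_set (sigma_sets (space M) (\<Union>i\<in>I. F i)) (sigma_sets (space M) (\<Union>i\<in>J. F i))"
  shows "indep_sets F (I \<union> J)"
proof (rule indep_setsI)
  show "F i \<subseteq> events" if "i \<in> I \<union> J" for i
    using that F by (auto simp: indep_sets_def)
  fix A K assume K: "K \<noteq> {}" "K \<subseteq> I \<union> J" "finite K" "\<forall>j\<in>K. A j \<in> F j"
  \<comment> \<open>The empty \<open>L\<close> is excluded because its intersection is
    \<open>UNIV\<close>, which need not be \<open>space M\<close>.\<close>
  have in_sigma: "(\<Inter>k\<in>L. A k) \<in> sigma_sets (space M) (\<Union>i\<in>N. F i)"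
    if "L \<subseteq> K" "L \<subseteq> N" "L \<noteq> {}" "indep_sets F N" for L N
  proof -
    have "(\<Union>i\<in>N. F i) \<subseteq> Pow (space M)"
      using that(4) sets.space_closed[of M] by (auto simp: indep_sets_def)
    then interpret sigma_algebra "space M" "sigma_sets (space M) (\<Union>i\<in>N. F i)"
      by (rule sigma_algebra_sigma_sets)
    show ?thesis
    proof (rule finite_INT)
      show "A k \<in> sigma_sets (space M) (\<Union>i\<in>N. F i)" if "k \<in> L" for k
        using that K \<open>L \<subseteq> K\<close> \<open>L \<subseteq> N\<close> by (intro sigma_sets.Basic) blast
    qed (use that K finite_subset[of L K] in auto)
  qed
  let ?K1 = "K \<inter> I" and ?K2 = "K \<inter> J"
  have K12: "K = ?K1 \<union> ?K2" using K by auto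
  have prod: "prob (\<Inter>j\<in>L. A j) = (\<Prod>j\<in>L. prob (A j))" if "L \<subseteq> K" "L \<subseteq> N" "L \<noteq> {}" "indep_sets F N" for L N
    using that K finite_subset[of L K] by (intro indep_setsD[OF that(4)]) auto
  \<comment> \<open>If one part is empty, \<open>K\<close> lies in the other block, whose own
    independence suffices.\<close>
  consider "?K1 = {}" | "?K2 = {}" | "?K1 \<noteq> {}" "?K2 \<noteq> {}" by auto
  then show "prob (\<Inter>j\<in>K. A j) = (\<Prod>j\<in>K. prob (A j))"
  proof cases
    case 1
    then show ?thesis using K12 K F by (intro prod[of K J]) auto
  next
    case 2
    then show ?thesis using K12 K F by (intro prod[of K I]) auto
  next
    case 3
    have "(\<Inter>j\<in>K. A j) = (\<Inter>j\<in>?K1. A j) \<inter> (\<Inter>j\<in>?K2. A j)"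
      using K by auto
    then have "prob (\<Inter>j\<in>K. A j) = prob (\<Inter>j\<in>?K1. A j) * prob (\<Inter>j\<in>?K2. A j)"
      using 3 F in_sigma[of ?K1 I] in_sigma[of ?K2 J] by (simp add: indep_setD[OF ind])
    also have "\<dots> = (\<Prod>j\<in>?K1. prob (A j)) * (\<Prod>j\<in>?K2. prob (A j))"
      using 3 F prod[of ?K1 I] prod[of ?K2 J] by simp
    also have "\<dots> = (\<Prod>j\<in>K. prob (A j))"
      using K disj by (subst (3) K12, subst prod.union_disjoint) auto
    finally show ?thesis .
  qed
qed

lemma indep_set_mono:
  assumes "indep_set A B" and "A' \<subseteq> A" and "B' \<subseteq> B"
  shows "indep_set A' B'"
  using assms unfolding indep_sets2_eq by blast

end

section \<open>Noise sources of the chain and their independence\<close>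

context pdmp_embedded_chain
begin

text \<open>The sources take values in three different types; passing to the fields they generate
  makes them members of one family, to which \<open>indep_sets\<close> applies.\<close>

definition source_field :: "(nat + nat) option \<Rightarrow> 'a measure" where
  "source_field k = (case k of
      None \<Rightarrow> generated_field M (state_space E) {0} Z
    | Some (Inl j) \<Rightarrow> generated_field M N\<^sub>\<epsilon> {j} \<epsilon>
    | Some (Inr j) \<Rightarrow> generated_field M N\<^sub>\<delta> {j} \<delta>)"

lemma eps_measurable: "\<epsilon> j \<in> M \<rightarrow>\<^sub>M N\<^sub>\<epsilon>" and delta_measurable: "\<delta> j \<in> M \<rightarrow>\<^sub>M N\<^sub>\<delta>"
  using eps_indep delta_indep by (auto simp: indep_vars_def)

lemma subalgebra_source_field: "subalgebra M (source_field k)"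
  by (auto simp: source_field_def split: option.split sum.split
      intro!: subalgebra_generated_field Z_measurable eps_measurable delta_measurable)

text \<open>Two gluings by \<open>indep_sets_Un\<close>: \<open>eps_delta_indep\<close> joins the
  two noise sequences, then \<open>noise_init_indep\<close> adds the initial state.\<close>

lemma indep_source_fields: "indep_sets (\<lambda>k. sets (source_field k)) UNIV"
proof -
  let ?F = "\<lambda>k. sets (source_field k)"
  let ?e = "\<lambda>j :: nat. Some (Inl j :: nat + nat)" and ?d = "\<lambda>j :: nat. Some (Inr j :: nat + nat)"
  let ?Ge = "generated_field M N\<^sub>\<epsilon> UNIV \<epsilon>" and ?Gd = "generated_field M N\<^sub>\<delta> UNIV \<delta>"
  have indep_e: "indep_sets ?F (range ?e)"
    using eps_indep by (intro indep_sets_image)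
      (auto simp: inj_on_def indep_vars_def source_field_def sets_generated_field)
  have indep_d: "indep_sets ?F (range ?d)"
    using delta_indep by (intro indep_sets_image)
      (auto simp: inj_on_def indep_vars_def source_field_def sets_generated_field)
  have sub: "subalgebra ?Ge (generated_field M N\<^sub>\<epsilon> {j} \<epsilon>)" "subalgebra ?Gd (generated_field M N\<^sub>\<delta> {j} \<delta>)" for j
    by (auto intro!: subalgebra_generated_field measurable_generated_field eps_measurable delta_measurable)
  have sub_e: "sigma_sets (space M) (\<Union>k\<in>range ?e. ?F k) \<subseteq> sets ?Ge"
    using sub(1) sets.sigma_sets_subset[of "\<Union>k\<in>range ?e. ?F k" ?Ge]
    by (auto simp: source_field_def subalgebra_def)
  have sub_d: "sigma_sets (space M) (\<Union>k\<in>range ?d. ?F k) \<subseteq> sets ?Gd"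
    using sub(2) sets.sigma_sets_subset[of "\<Union>k\<in>range ?d. ?F k" ?Gd]
    by (auto simp: source_field_def subalgebra_def)
  have indep_ed: "indep_sets ?F (range ?e \<union> range ?d)"
    using indep_set_mono[OF eps_delta_indep sub_e sub_d] by (intro indep_sets_Un indep_e indep_d) auto
  have "subalgebra M ?Ge" "subalgebra M ?Gd"
    by (auto intro!: subalgebra_generated_field eps_measurable delta_measurable)
  note J = subalgebra_join2(2,3)[OF this]
  have "?F k \<subseteq> sets (join_fields M {?Ge, ?Gd})" if "k \<in> range ?e \<union> range ?d" for k
  proof -
    from that consider j where "k = ?e j" | j where "k = ?d j" by blast
    then show ?thesis
    proof cases
      case (1 j)
      then show ?thesis using subalgebra_trans[OF J(1) sub(1)] by (simp add: source_field_def subalgebra_def)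
    next
      case (2 j)
      then show ?thesis using subalgebra_trans[OF J(2) sub(2)] by (simp add: source_field_def subalgebra_def)
    qed
  qed
  then have "(\<Union>k\<in>range ?e \<union> range ?d. ?F k) \<subseteq> sets (join_fields M {?Ge, ?Gd})"
    by (rule UN_least)
  from sets.sigma_sets_subset[OF this]
  have sub_ed: "sigma_sets (space M) (\<Union>k\<in>range ?e \<union> range ?d. ?F k) \<subseteq> sets (join_fields M {?Ge, ?Gd})"
    by (simp only: space_join_fields)
  have sub_0: "sigma_sets (space M) (\<Union>k\<in>{None}. ?F k) \<subseteq> sets (generated_field M (state_space E) {0} Z)"
    using sets.sigma_sets_subset[of _ "generated_field M (state_space E) {0} Z"]
    by (auto simp: source_field_def)
  have "indep_sets ?F {None}"
  proof (rule indep_setsI)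
    show "?F k \<subseteq> events" for k
      using subalgebra_source_field by (simp add: subalgebra_def)
    show "prob (\<Inter>j\<in>J. A j) = (\<Prod>j\<in>J. prob (A j))" if "J \<noteq> {}" "J \<subseteq> {None}" for J A
      using that by (auto simp: subset_singleton_iff)
  qed
  then have "indep_sets ?F ({None} \<union> (range ?e \<union> range ?d))"
    using indep_set_mono[OF noise_init_indep sub_0 sub_ed] by (intro indep_sets_Un indep_ed) auto
  moreover have "{None} \<union> (range ?e \<union> range ?d) = UNIV"
    by (auto simp: image_iff) (metis not_None_eq sum.exhaust)
  ultimately show ?thesis by simp
qed

text \<open>Disjoint blocks of independent pi-systems generate independent sigma-fields;
  \<open>case_bool\<close> matches the encoding of \<open>indep_set\<close> as a family over the
  booleans.\<close>

lemma indep_joined_sources: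
  assumes "K \<inter> L = {}"
  shows "indep_set (sets (join_fields M (source_field ` K))) (sets (join_fields M (source_field ` L)))"
proof -
  have "indep_sets (\<lambda>b. sigma_sets (space M) (\<Union>k\<in>case_bool K L b. sets (source_field k))) UNIV"
    using assms indep_source_fields
    by (intro indep_sets_collect_sigma)
      (auto intro: indep_sets_mono_index sets.Int_stable simp: disjoint_family_on_def split: bool.splits)
  then have "indep_set (sigma_sets (space M) (\<Union>k\<in>K. sets (source_field k)))
      (sigma_sets (space M) (\<Union>k\<in>L. sets (source_field k)))"
    unfolding indep_set_def by (rule indep_sets_mono_sets) (auto split: bool.split)
  moreover have "sets (join_fields M (source_field ` N)) = sigma_sets (space M) (\<Union>k\<in>N. sets (source_field k))" for N
    by (subst sets_join_fields) (auto intro: subalgebra_source_field)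
  ultimately show ?thesis by simp
qed

lemma measurable_joined_sources:
  shows "None \<in> K \<Longrightarrow> Z 0 \<in> join_fields M (source_field ` K) \<rightarrow>\<^sub>M state_space E"
    and "Some (Inl j) \<in> K \<Longrightarrow> \<epsilon> j \<in> join_fields M (source_field ` K) \<rightarrow>\<^sub>M N\<^sub>\<epsilon>"
    and "Some (Inr j) \<in> K \<Longrightarrow> \<delta> j \<in> join_fields M (source_field ` K) \<rightarrow>\<^sub>M N\<^sub>\<delta>"
proof -
  have sub: "subalgebra (join_fields M (source_field ` K)) (source_field k)" if "k \<in> K" for k
    using that subalgebra_source_field by (intro subalgebra_join_fields_upper) auto
  show "Z 0 \<in> join_fields M (source_field ` K) \<rightarrow>\<^sub>M state_space E" if "None \<in> K"
    using measurable_generated_field[of 0 "{0}" Z, OF _ Z_measurable]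
    by (intro measurable_from_subalg[OF sub[OF that]]) (simp add: source_field_def)
  show "\<epsilon> j \<in> join_fields M (source_field ` K) \<rightarrow>\<^sub>M N\<^sub>\<epsilon>" if "Some (Inl j) \<in> K"
    using measurable_generated_field[of j "{j}" \<epsilon>, OF _ eps_measurable]
    by (intro measurable_from_subalg[OF sub[OF that]]) (simp add: source_field_def)
  show "\<delta> j \<in> join_fields M (source_field ` K) \<rightarrow>\<^sub>M N\<^sub>\<delta>" if "Some (Inr j) \<in> K"
    using measurable_generated_field[of j "{j}" \<delta>, OF _ delta_measurable]
    by (intro measurable_from_subalg[OF sub[OF that]]) (simp add: source_field_def)
qed

section \<open>Measurability of the chain and separation of a single step\<close>

lemma chain_step_measurable:
  assumes sp: "space K = space M"
    and K: "Z a \<in> K \<rightarrow>\<^sub>M state_space E" "\<epsilon> a \<in> K \<rightarrow>\<^sub>M N\<^sub>\<epsilon>" "\<delta> a \<in> K \<rightarrow>\<^sub>M N\<^sub>\<delta>"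
  shows "S (Suc a) \<in> K \<rightarrow>\<^sub>M time_space" and "Z (Suc a) \<in> K \<rightarrow>\<^sub>M state_space E"
proof -
  have "(\<lambda>\<omega>. \<phi> (Z a \<omega>) (\<delta> a \<omega>)) \<in> K \<rightarrow>\<^sub>M time_space"
    using measurable_compose[OF measurable_Pair[OF K(1,3)] phi_measurable] by simp
  then show S: "S (Suc a) \<in> K \<rightarrow>\<^sub>M time_space"
    using S_rec[of "Suc a"] by (subst measurable_cong[of K]) (auto simp: sp)
  have "(\<lambda>\<omega>. \<psi> (Z a \<omega>) (S (Suc a) \<omega>) (\<epsilon> a \<omega>)) \<in> K \<rightarrow>\<^sub>M state_space E"
    using measurable_compose[OF measurable_Pair[OF K(1) measurable_Pair[OF S K(2)]] psi_measurable] by simp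
  then show "Z (Suc a) \<in> K \<rightarrow>\<^sub>M state_space E"
    using Z_rec[of "Suc a"] by (subst measurable_cong[of K]) (auto simp: sp)
qed

text \<open>Used with \<open>a = 0\<close> for the past and with \<open>a = Suc m\<close> for the
  future of the step from \<open>m\<close>; both uses avoid the noise of index
  \<open>m\<close>.\<close>

lemma chain_measurable:
  assumes "a \<le> b" and "space K = space M" and "Z a \<in> K \<rightarrow>\<^sub>M state_space E"
    and "\<And>k. a \<le> k \<Longrightarrow> k < b \<Longrightarrow> \<epsilon> k \<in> K \<rightarrow>\<^sub>M N\<^sub>\<epsilon>" "\<And>k. a \<le> k \<Longrightarrow> k < b \<Longrightarrow> \<delta> k \<in> K \<rightarrow>\<^sub>M N\<^sub>\<delta>"
  shows "Z b \<in> K \<rightarrow>\<^sub>M state_space E"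
  using assms
proof (induction b rule: dec_induct)
  case (step b)
  then show ?case by (intro chain_step_measurable(2)) auto
qed

lemma subalgebra_jump_filtration:
  assumes sp: "space K = space M" and "S j \<in> K \<rightarrow>\<^sub>M time_space"
  shows "subalgebra K (jump_filtration M S j t)"
  unfolding jump_filtration_def
proof (rule subalgebra_generated_field)
  have [measurable]: "S j \<in> borel_measurable K"
    using assms(2) by (simp add: measurable_restrict_space2_iff)
  show "jump_indicator S j u \<in> borel_measurable K" for u
    unfolding jump_indicator_def by measurable
qed (rule sp)

text \<open>The witnesses are \<sigma>(Z_m) \<or> D for \<open>A\<close> and H \<or> Q for
  \<open>W\<close>. Only measurability of \<open>S\<close> and \<open>Z\<close> is exported with
  them, since the later inclusions follow from it. The times carry the index \<open>Suc k\<close>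
  because S_{k+1} is produced by step k.\<close>

lemma step_cond_indep:
  obtains A W where
    "cond_indep M (generated_field M (state_space E) {m, Suc m} Z) A W"
    "S (Suc m) \<in> A \<rightarrow>\<^sub>M time_space"
    "\<And>k. Z k \<in> W \<rightarrow>\<^sub>M state_space E"
    "\<And>k. k \<noteq> m \<Longrightarrow> S (Suc k) \<in> W \<rightarrow>\<^sub>M time_space"
proof -
  let ?J = "{Some (Inl m), Some (Inr m)}" and ?T = "join_fields M {}"
  let ?D = "join_fields M (source_field ` ?J)" and ?Q = "join_fields M (source_field ` (- ?J))"
  let ?H1 = "generated_field M (state_space E) {m} Z"
  let ?H2 = "generated_field M (state_space E) {m, Suc m} Z"
  have MD: "subalgebra M ?D" and MQ: "subalgebra M ?Q"
    by (auto intro!: subalgebra_join_fields_least subalgebra_source_field)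
  have MH: "subalgebra M (generated_field M (state_space E) I Z)" for I
    by (intro subalgebra_generated_field Z_measurable) simp
  have MT: "subalgebra M ?T"
    by (intro subalgebra_join_fields_least) auto
  have TK: "subalgebra K ?T" if "space K = space M" for K
    using that by (intro subalgebra_join_fields_least) auto
  \<comment> \<open>Up to time \<open>m\<close> only \<open>Z 0\<close> and noises of index below
    \<open>m\<close> enter, all of them outside \<open>?J\<close>.\<close>
  have ZQ: "Z k \<in> ?Q \<rightarrow>\<^sub>M state_space E" if "k \<le> m" for k
    using that by (intro chain_measurable[of 0 k] measurable_joined_sources) auto
  let ?A = "join_fields M {?H1, ?D}" and ?W = "join_fields M {?H2, ?Q}"
  note A = subalgebra_join2[OF MH MD, of "{m}"] and W = subalgebra_join2[OF MH MQ, of "{m, Suc m}"]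
  have noise_A: "\<epsilon> m \<in> ?A \<rightarrow>\<^sub>M N\<^sub>\<epsilon>" "\<delta> m \<in> ?A \<rightarrow>\<^sub>M N\<^sub>\<delta>"
    by (rule measurable_from_subalg[OF A(3)], rule measurable_joined_sources, simp)+
  have ZA: "Z m \<in> ?A \<rightarrow>\<^sub>M state_space E"
    using Z_measurable by (intro measurable_from_subalg[OF A(2)] measurable_generated_field) auto
  note step_A = chain_step_measurable[OF space_join_fields ZA noise_A]
  have "cond_indep M ?T ?D ?Q"
    using MD MQ by (intro cond_indep_trivial indep_joined_sources) auto
  \<comment> \<open>First enlargement, on the side of the past: \<open>?H1\<close> lies in
    \<open>?Q\<close>.\<close>
  then have "cond_indep M ?H1 ?D ?Q"
  proof (rule cond_indep_weak_union')
    show "subalgebra (join_fields M {?T, ?Q}) ?H1"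
      using measurable_from_subalg[OF subalgebra_join2(3)[OF MT MQ] ZQ]
      by (intro subalgebra_generated_field) auto
  qed (simp add: TK)
  \<comment> \<open>After the swap the second enlargement is on the noise side: Z_{m+1} is a
    function of Z_m and the noise of index \<open>m\<close>, so \<open>?H2\<close> lies in
    \<open>?A\<close>.\<close>
  from cond_indep_sym[OF this] have "cond_indep M ?H2 ?Q ?A"
  proof (rule cond_indep_weak_union)
    show "subalgebra ?H2 ?H1"
      by (intro subalgebra_generated_field measurable_generated_field Z_measurable) auto
    show "subalgebra ?A ?H2"
      using ZA step_A(2) by (intro subalgebra_generated_field) auto
  qed
  \<comment> \<open>Weak union with unchanged conditioning field, only to enlarge \<open>?Q\<close>
    to \<open>?W\<close>.\<close>
  then have "cond_indep M ?H2 ?A ?W"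
    by (rule cond_indep_weak_union[OF cond_indep_sym _ W(2)]) (rule subalgebra_refl)
  moreover have "S (Suc m) \<in> ?A \<rightarrow>\<^sub>M time_space" by (rule step_A)
  moreover have noise_W: "\<epsilon> k \<in> ?W \<rightarrow>\<^sub>M N\<^sub>\<epsilon>" "\<delta> k \<in> ?W \<rightarrow>\<^sub>M N\<^sub>\<delta>" if "k \<noteq> m" for k
    using that by - (rule measurable_from_subalg[OF W(3)], rule measurable_joined_sources, simp)+
  moreover have ZW: "Z k \<in> ?W \<rightarrow>\<^sub>M state_space E" for k
  proof (cases "k \<le> m")
    case True
    then show ?thesis using ZQ by (intro measurable_from_subalg[OF W(3)])
  next
    case False
    \<comment> \<open>The chain restarts at \<open>Suc m\<close>: this state comes from
      \<open>?H2\<close>, and the later noises have index different from \<open>m\<close>.\<close>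
    have "Z (Suc m) \<in> ?W \<rightarrow>\<^sub>M state_space E"
      using Z_measurable by (intro measurable_from_subalg[OF W(2)] measurable_generated_field) auto
    then show ?thesis
      using False noise_W by (intro chain_measurable[of "Suc m" k]) auto
  qed
  moreover have "S (Suc k) \<in> ?W \<rightarrow>\<^sub>M time_space" if "k \<noteq> m" for k
    using chain_step_measurable(1)[OF space_join_fields ZW noise_W[OF that]] .
  ultimately show thesis by (intro that)
qed

text \<open>Here \<open>m\<close> is \<open>i - 1\<close> in the first pair of claims of the theorem
  and \<open>i\<close> in the second; the family \<open>\<tau>\<close> covers both the times t_j and
  the constant time s.\<close>

lemma jump_cond_indep:
  fixes \<tau> :: "nat \<Rightarrow> real" and s t :: real
  assumes "m < n"
  defines "\<G> \<equiv> generated_field M (state_space E) {0..n} Z"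
    and "\<H> \<equiv> generated_field M (state_space E) {m, Suc m} Z"
    and "\<F> \<equiv> jump_filtration M S"
  defines "\<O> \<equiv> join_fields M ((\<lambda>j. \<F> j (\<tau> j)) ` ({1..n} - {Suc m}))"
  shows "cond_indep M \<G> \<O> (\<F> (Suc m) t)"
    and "cond_indep M \<H> (\<F> (Suc m) t) \<G>"
    and "cond_indep M (join_fields M {\<G>, \<F> (Suc m) s}) \<O> (\<F> (Suc m) t)"
    and "cond_indep M (join_fields M {\<H>, \<F> (Suc m) s}) (\<F> (Suc m) t) \<G>"
proof -
  obtain A W where ci: "cond_indep M \<H> A W"
    and A: "S (Suc m) \<in> A \<rightarrow>\<^sub>M time_space"
    and ZW: "\<And>k. Z k \<in> W \<rightarrow>\<^sub>M state_space E"
    and SW: "\<And>k. k \<noteq> m \<Longrightarrow> S (Suc k) \<in> W \<rightarrow>\<^sub>M time_space"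
    unfolding \<H>_def by (rule step_cond_indep) blast
  note sub = cond_indepD[OF ci]
  have sp: "space A = space M" "space W = space M"
    using sub by (auto simp: subalgebra_def)
  have FA: "subalgebra A (\<F> (Suc m) u)" for u
    unfolding \<F>_def using sp(1) A by (rule subalgebra_jump_filtration)
  have MF: "subalgebra M (\<F> j u)" for j u
    unfolding \<F>_def by (intro subalgebra_jump_filtration S_measurable) simp
  have OW: "subalgebra W \<O>"
    unfolding \<O>_def
  proof (rule subalgebra_join_fields_least)
    fix H assume "H \<in> (\<lambda>j. \<F> j (\<tau> j)) ` ({1..n} - {Suc m})"
    \<comment> \<open>Jump indices start at 1, so each is some \<open>Suc k\<close>, and differing
      from \<open>Suc m\<close> means \<open>k \<noteq> m\<close>.\<close>
    then obtain k where "H = \<F> (Suc k) (\<tau> (Suc k))" "k \<noteq> m"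
      by (auto simp: image_iff) (metis Suc_pred less_eq_Suc_le One_nat_def)
    then show "subalgebra M H" "subalgebra W H"
      using sp(2) SW MF unfolding \<F>_def by (auto intro: subalgebra_jump_filtration)
  qed (rule sp)
  have GW: "subalgebra W \<G>"
    unfolding \<G>_def using sp(2) ZW by (rule subalgebra_generated_field)
  have GH: "subalgebra \<G> \<H>"
    unfolding \<G>_def \<H>_def using \<open>m < n\<close> Z_measurable
    by (intro subalgebra_generated_field measurable_generated_field) auto
  show "cond_indep M \<H> (\<F> (Suc m) t) \<G>"
    using ci FA GW by (rule cond_indep_mono)
  \<comment> \<open>\<open>\<G>\<close> lies between \<open>\<H>\<close> and the join of
    \<open>\<H>\<close> with \<open>W\<close>, so it can replace \<open>\<H>\<close> as the
    conditioning field.\<close>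
  have ciG: "cond_indep M \<G> W A"
    by (rule cond_indep_sym[OF cond_indep_weak_union'[OF ci GH subalgebra_trans[OF _ GW]]])
      (rule subalgebra_join2(3)[OF sub(1,3)])
  then show "cond_indep M \<G> \<O> (\<F> (Suc m) t)"
    using OW FA by (rule cond_indep_mono)
  \<comment> \<open>The past of the jump process is contained in \<open>A\<close>, so adding it to
    \<open>K\<close> stays below the join of \<open>K\<close> and \<open>A\<close>, and weak union
    applies.\<close>
  have past: "cond_indep M (join_fields M {K, \<F> (Suc m) s}) W A" if "cond_indep M K W A" for K
  proof -
    note K = cond_indepD(1,3)[OF that] subalgebra_join2[OF cond_indepD(1,3)[OF that]]
    show ?thesis
    proof (rule cond_indep_weak_union'[OF that])
      show "subalgebra (join_fields M {K, \<F> (Suc m) s}) K"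
        using K(1) MF by (rule subalgebra_join2(2))
      show "subalgebra (join_fields M {K, A}) (join_fields M {K, \<F> (Suc m) s})"
        using K MF subalgebra_trans[OF K(5) FA] by (intro subalgebra_join_fields_least) auto
    qed
  qed
  show "cond_indep M (join_fields M {\<G>, \<F> (Suc m) s}) \<O> (\<F> (Suc m) t)"
    using past[OF ciG] OW FA by (rule cond_indep_mono)
  show "cond_indep M (join_fields M {\<H>, \<F> (Suc m) s}) (\<F> (Suc m) t) \<G>"
    using cond_indep_sym[OF past[OF cond_indep_sym[OF ci]]] FA GW by (rule cond_indep_mono)
qed

end

theorem proposition4p7:
  fixes M :: "'a measure"
    and E :: "'e::{metric_space, second_countable_topology} set"
    and \<nu>\<^sub>0 :: "'e measure"
    and Z :: "nat \<Rightarrow> 'a \<Rightarrow> 'e"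
    and S :: "nat \<Rightarrow> 'a \<Rightarrow> real"
    and N\<^sub>\<epsilon> :: "'b measure"
    and N\<^sub>\<delta> :: "'c measure"
    and \<epsilon> :: "nat \<Rightarrow> 'a \<Rightarrow> 'b"
    and \<delta> :: "nat \<Rightarrow> 'a \<Rightarrow> 'c"
    and \<phi> :: "'e \<Rightarrow> 'c \<Rightarrow> real"
    and \<psi> :: "'e \<Rightarrow> real \<Rightarrow> 'b \<Rightarrow> 'e"
    and n :: nat
  defines "\<G> \<equiv> generated_field M (state_space E) {0..n} Z"
    and "\<F> \<equiv> jump_filtration M S"
  assumes chain: "pdmp_embedded_chain M E \<nu>\<^sub>0 Z S N\<^sub>\<epsilon> N\<^sub>\<delta> \<epsilon> \<delta> \<phi> \<psi>"
    and n: "n \<ge> 1"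
  shows "(\<forall>i\<in>{1..n}. \<forall>\<tau> :: nat \<Rightarrow> real. \<forall>t :: real.
            (\<forall>j\<in>{1..n} - {i}. \<tau> j \<ge> 0) \<longrightarrow> t > 0 \<longrightarrow>
              cond_indep M \<G> (join_fields M ((\<lambda>j. \<F> j (\<tau> j)) ` ({1..n} - {i}))) (\<F> i t)
            \<and> cond_indep M (generated_field M (state_space E) {i - 1, i} Z) (\<F> i t) \<G>)
       \<and> (\<forall>i\<in>{0..n - 1}. \<forall>s t :: real. 0 \<le> s \<longrightarrow> s < t \<longrightarrow>
              cond_indep M (join_fields M {\<G>, \<F> (i + 1) s})
                (join_fields M ((\<lambda>j. \<F> j s) ` ({1..n} - {i + 1}))) (\<F> (i + 1) t)
            \<and> cond_indep M
                (join_fields M {generated_field M (state_space E) {i, i + 1} Z, \<F> (i + 1) s})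
                (\<F> (i + 1) t) \<G>)"
proof -
  interpret pdmp_embedded_chain M E \<nu>\<^sub>0 Z S N\<^sub>\<epsilon> N\<^sub>\<delta> \<epsilon> \<delta> \<phi> \<psi>
    by (rule chain)
  note ci = jump_cond_indep[of _ n, folded \<G>_def \<F>_def]
  show ?thesis
  proof (intro conjI ballI allI impI)
    fix i :: nat and \<tau> :: "nat \<Rightarrow> real" and t :: real
    assume "i \<in> {1..n}"
    \<comment> \<open>Since \<open>i\<close> is at least 1, the truncated subtraction is exact and
      \<open>m = i - 1\<close> is admissible.\<close>
    then have i: "i - 1 < n" "Suc (i - 1) = i" by auto
    show "cond_indep M \<G> (join_fields M ((\<lambda>j. \<F> j (\<tau> j)) ` ({1..n} - {i}))) (\<F> i t)"
      using ci(1)[OF i(1)] by (simp only: i(2))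
    show "cond_indep M (generated_field M (state_space E) {i - 1, i} Z) (\<F> i t) \<G>"
      using ci(2)[OF i(1)] by (simp only: i(2))
  next
    fix i :: nat and s t :: real
    assume "i \<in> {0..n - 1}"
    with n have i: "i < n" by auto
    show "cond_indep M (join_fields M {\<G>, \<F> (i + 1) s})
        (join_fields M ((\<lambda>j. \<F> j s) ` ({1..n} - {i + 1}))) (\<F> (i + 1) t)"
      using ci(3)[OF i, of s "\<lambda>_. s"] by simp
    show "cond_indep M (join_fields M {generated_field M (state_space E) {i, i + 1} Z, \<F> (i + 1) s})
        (\<F> (i + 1) t) \<G>"
      using ci(4)[OF i] by simp
  qed
qed

end
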